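(* Consider the problem $\phi_*=\min_{x\in\mathbb{R}^n}\phi(x)$, $\phi=\tilde f+\tilde h=f+h$, and the assumptions (A1), (A2), (A3) given in the context, with $\mu>0$ and $T_{\bar\varepsilon}>0$. Let $\bar\varepsilon>0$ and run the QCC framework described in the context with $\tau$ given by $$\frac{1}{\tau}=1+\frac{\mu\bar\varepsilon}{8T_{\bar\varepsilon}^2}=1+\frac{\mu\bar\varepsilon}{8(\bar M_f^2+\bar\varepsilon\bar L_f)}.$$ Assume that $\mathrm{dom}\,h$ is bounded with diameter $D>0$, and set $$\bar t:=\bar M_f^2+\left(\frac{\bar L_f}{2}+1\right)D^2 .$$ Then, if $$j\ \ge\ 1+\left[1+\frac{8(\bar M_f^2+\bar\varepsilon\bar L_f)}{\mu\bar\varepsilon}\right]\log\left(\frac{4\bar t}{3\bar\varepsilon}\right),$$ we have $t_j\le\bar\varepsilon$, and QCC finds an $\bar\varepsilon$-optimal solution of the problem in at most $$1+\left[1+\frac{8(\bar M_f^2+\bar\varepsilon\bar L_f)}{\mu\bar\varepsilon}\right]\log\left(\frac{4\bar t}{3\bar\varepsilon}\right)$$ iterations.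
   Context: Notation. A proper function $\Psi:\mathbb{R}^n\to(-\infty,+\infty]$ is $\mu$-convex ($\mu\ge0$) if $\Psi(\alpha z+(1-\alpha)z')\le\alpha\Psi(z)+(1-\alpha)\Psi(z')-\frac{\alpha(1-\alpha)\mu}{2}\|z-z'\|^2$ for all $z,z'\in\mathrm{dom}\,\Psi$, $\alpha\in[0,1]$ (Euclidean norm). $\overline{\mathrm{Conv}}_\mu(\mathbb{R}^n)$ is the set of proper lower semicontinuous $\mu$-convex functions, and $\overline{\mathrm{Conv}}(\mathbb{R}^n)$ is the case $\mu=0$. $\log$ is the natural logarithm. Problem. $\tilde f\in\overline{\mathrm{Conv}}_\mu(\mathbb{R}^n)$, $\tilde h\in\overline{\mathrm{Conv}}(\mathbb{R}^n)$, $\mathrm{dom}\,\tilde h\subseteq\mathrm{dom}\,\tilde f$, $\phi=\tilde f+\tilde h$, $\phi_*=\min\phi$. A subgradient oracle $\tilde f':\mathrm{dom}\,\tilde h\to\mathbb{R}^n$ with $\tilde f'(x)\in\partial\tilde f(x)$ is given. Put $f(x)=\tilde f(x)-\frac{\mu}{2}\|x\|^2$, $h(x)=\tilde h(x)+\frac{\mu}{2}\|x\|^2$, $f'(x)=\tilde f'(x)-\mu x$, so $\phi=f+h$, $f'(x)\in\partial f(x)$ and $\mathrm{dom}\,h=\mathrm{dom}\,\tilde h$. Let $\ell_f(u;x)=f(x)+\langle f'(x),u-x\rangle$ and $q_{\tilde f}(u;x)=\tilde f(x)+\langle\tilde f'(x),u-x\rangle+\frac{\mu}{2}\|u-x\|^2$;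 one has $\ell_f(\cdot;x)+h=q_{\tilde f}(\cdot;x)+\tilde h$. Assumptions. (A1) $f\in\overline{\mathrm{Conv}}(\mathbb{R}^n)$, $h\in\overline{\mathrm{Conv}}_\mu(\mathbb{R}^n)$, $\mathrm{dom}\,h\subset\mathrm{dom}\,f$, and the subgradient oracle $f':\mathrm{dom}\,h\to\mathbb{R}^n$ of $f$ is available. (A2) The set $X^*$ of optimal solutions is nonempty. (A3) There are $M_f,L_f\ge0$ with $\|f'(u)-f'(v)\|\le 2M_f+L_f\|u-v\|$ for all $u,v\in\mathrm{dom}\,h$. Among all pairs $(M_f,L_f)\in\mathbb{R}_+^2$ satisfying (A3), $(\bar M_f,\bar L_f)=(\bar M_f(\bar\varepsilon),\bar L_f(\bar\varepsilon))$ is the unique one minimizing $M_f^2+\bar\varepsilon L_f$, and $T_{\bar\varepsilon}:=(\bar M_f^2+\bar\varepsilon\bar L_f)^{1/2}$. QCC framework (any realization of the choices below is allowed). Step 0: $x_0\in\mathrm{dom}\,h$, $\bar\varepsilon>0$, $\tau\in(0,1)$ are given; $y_0=x_0$, $j=1$. Step 1: if $j=1$, find $\Gamma_1\in\overline{\mathrm{Conv}}_\mu(\mathbb{R}^n)$ with $q_{\tilde f}(\cdot;x_0)+\tilde h\le\Gamma_1\le\phi$. If $j\ge2$, let $\Gamma_j=\Gamma^+$ be any function produced from $(\Gamma,x)=(\Gamma_{j-1},x_{j-1})$ such that $\Gamma^+\in\overline{\mathrm{Conv}}_\mu(\mathbb{R}^n)$ and $\tau\bar\Gamma+(1-\tau)[q_{\tilde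 f}(\cdot;x)+\tilde h]\le\Gamma^+\le\phi$ for some $\bar\Gamma\in\overline{\mathrm{Conv}}_\mu(\mathbb{R}^n)$ with $\bar\Gamma(x)=\Gamma(x)$ and $x=\mathrm{argmin}_{u\in\mathbb{R}^n}\bar\Gamma(u)$. Step 2: compute $x_j=\mathrm{argmin}_{u\in\mathbb{R}^n}\Gamma_j(u)$, choose $y_j\in\mathrm{Argmin}\{\phi(x):x\in\{x_0,\dots,x_j\}\}$, set $m_j=\Gamma_j(x_j)$, $t_j=\phi(y_j)-m_j$. Step 3: $j\leftarrow j+1$, go to Step 1. An $\bar\varepsilon$-optimal solution is a point $y$ with $\phi(y)-\phi_*\le\bar\varepsilon$; the candidate solution at iteration $j$ is $y_j$.
   Formalization: The bound on the number of iterations is rounded up to an integer and at least one iteration is allowed, since the unrounded claim fails: the bound can be negative, and for some bounds between 1 and 2 the first iterate is not ε̄-optimal. *)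

theory Defs
  imports "HOL-Analysis.Analysis"
begin

section \<open>Convex functions with values in \<open>(-\<infinity>, +\<infinity>]\<close>\<close>

text \<open>Functions into \<open>(-\<infinity>, +\<infinity>]\<close> are \<^typ>\<open>ereal\<close>-valued functions; the value \<open>-\<infinity>\<close> is
  excluded by properness.\<close>

definition edom :: "('a \<Rightarrow> ereal) \<Rightarrow> 'a set" where
  "edom \<Psi> = {x. \<Psi> x < \<infinity>}"

definition proper :: "('a \<Rightarrow> ereal) \<Rightarrow> bool" where
  "proper \<Psi> \<longleftrightarrow> (\<forall>x. \<Psi> x \<noteq> -\<infinity>) \<and> edom \<Psi> \<noteq> {}"

definition lower_semicont :: "('a::topological_space \<Rightarrow> ereal) \<Rightarrow> bool" where
  "lower_semicont \<Psi> \<longleftrightarrow> (\<forall>x. \<Psi> x \<le> Liminf (at x) \<Psi>)"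

definition mu_convex :: "real \<Rightarrow> ('a::euclidean_space \<Rightarrow> ereal) \<Rightarrow> bool" where
  "mu_convex \<mu> \<Psi> \<longleftrightarrow>
     (\<forall>z\<in>edom \<Psi>. \<forall>z'\<in>edom \<Psi>. \<forall>\<alpha>\<in>{0..1}.
        \<Psi> (\<alpha> *\<^sub>R z + (1 - \<alpha>) *\<^sub>R z')
          \<le> ereal \<alpha> * \<Psi> z + ereal (1 - \<alpha>) * \<Psi> z'
             - ereal (\<alpha> * (1 - \<alpha>) * \<mu> / 2 * (norm (z - z'))\<^sup>2))"

definition Conv :: "real \<Rightarrow> ('a::euclidean_space \<Rightarrow> ereal) set" where
  "Conv \<mu> = {\<Psi>. proper \<Psi> \<and> lower_semicont \<Psi> \<and> mu_convex \<mu> \<Psi>}"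

definition subdifferential :: "('a::euclidean_space \<Rightarrow> ereal) \<Rightarrow> 'a \<Rightarrow> 'a set" where
  "subdifferential \<Psi> x = {g. \<forall>u. \<Psi> x + ereal (g \<bullet> (u - x)) \<le> \<Psi> u}"

definition Argmin :: "('a \<Rightarrow> ereal) \<Rightarrow> 'a set \<Rightarrow> 'a set" where
  "Argmin \<Psi> S = {x \<in> S. \<forall>u\<in>S. \<Psi> x \<le> \<Psi> u}"


section \<open>The composite problem\<close>

text \<open>Below, \<open>ft\<close>, \<open>ht\<close>, \<open>ft'\<close> are the original data \<open>(f~, h~, f~')\<close>; moving the quadratic
  \<open>\<mu>/2 \<parallel>\<cdot>\<parallel>\<^sup>2\<close> from the first summand to the second gives \<open>(f, h, f')\<close>.\<close>

definition composite_problem ::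
  "real \<Rightarrow> ('a::euclidean_space \<Rightarrow> ereal) \<Rightarrow> ('a \<Rightarrow> ereal) \<Rightarrow> ('a \<Rightarrow> 'a) \<Rightarrow> bool" where
  "composite_problem \<mu> ft ht ft' \<longleftrightarrow>
     ft \<in> Conv \<mu> \<and> ht \<in> Conv 0 \<and> edom ht \<subseteq> edom ft \<and>
     (\<forall>x\<in>edom ht. ft' x \<in> subdifferential ft x)"

definition objective :: "('a \<Rightarrow> ereal) \<Rightarrow> ('a \<Rightarrow> ereal) \<Rightarrow> 'a \<Rightarrow> ereal" where
  "objective ft ht = (\<lambda>x. ft x + ht x)"

definition f_part :: "real \<Rightarrow> ('a::euclidean_space \<Rightarrow> ereal) \<Rightarrow> 'a \<Rightarrow> ereal" where
  "f_part \<mu> ft = (\<lambda>x. ft x - ereal (\<mu> / 2 * (norm x)\<^sup>2))"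

definition h_part :: "real \<Rightarrow> ('a::euclidean_space \<Rightarrow> ereal) \<Rightarrow> 'a \<Rightarrow> ereal" where
  "h_part \<mu> ht = (\<lambda>x. ht x + ereal (\<mu> / 2 * (norm x)\<^sup>2))"

definition f_oracle :: "real \<Rightarrow> ('a::euclidean_space \<Rightarrow> 'a) \<Rightarrow> 'a \<Rightarrow> 'a" where
  "f_oracle \<mu> ft' = (\<lambda>x. ft' x - \<mu> *\<^sub>R x)"

definition q_model ::
  "real \<Rightarrow> ('a::euclidean_space \<Rightarrow> ereal) \<Rightarrow> ('a \<Rightarrow> 'a) \<Rightarrow> 'a \<Rightarrow> 'a \<Rightarrow> ereal" where
  "q_model \<mu> ft ft' u x =
     ft x + ereal (ft' x \<bullet> (u - x)) + ereal (\<mu> / 2 * (norm (u - x))\<^sup>2)"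

definition min_value :: "('a \<Rightarrow> ereal) \<Rightarrow> ereal" where
  "min_value \<phi> = (INF x. \<phi> x)"

definition eps_optimal :: "('a \<Rightarrow> ereal) \<Rightarrow> real \<Rightarrow> 'a \<Rightarrow> bool" where
  "eps_optimal \<phi> \<epsilon> y \<longleftrightarrow> \<phi> y - min_value \<phi> \<le> ereal \<epsilon>"


section \<open>Assumptions and the constants derived from them\<close>

definition assumption_A1 ::
  "real \<Rightarrow> ('a::euclidean_space \<Rightarrow> ereal) \<Rightarrow> ('a \<Rightarrow> ereal) \<Rightarrow> ('a \<Rightarrow> 'a) \<Rightarrow> bool" where
  "assumption_A1 \<mu> f h f' \<longleftrightarrow>
     f \<in> Conv 0 \<and> h \<in> Conv \<mu> \<and> edom h \<subseteq> edom f \<and>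
     (\<forall>x\<in>edom h. f' x \<in> subdifferential f x)"

definition assumption_A2 :: "('a \<Rightarrow> ereal) \<Rightarrow> bool" where
  "assumption_A2 \<phi> \<longleftrightarrow> Argmin \<phi> UNIV \<noteq> {}"

definition A3_pairs :: "'a::euclidean_space set \<Rightarrow> ('a \<Rightarrow> 'a) \<Rightarrow> (real \<times> real) set" where
  "A3_pairs S f' =
     {(M, L). 0 \<le> M \<and> 0 \<le> L \<and>
        (\<forall>u\<in>S. \<forall>v\<in>S. norm (f' u - f' v) \<le> 2 * M + L * norm (u - v))}"

definition assumption_A3 :: "'a::euclidean_space set \<Rightarrow> ('a \<Rightarrow> 'a) \<Rightarrow> bool" where
  "assumption_A3 S f' \<longleftrightarrow> A3_pairs S f' \<noteq> {}"

definition best_pair ::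
  "'a::euclidean_space set \<Rightarrow> ('a \<Rightarrow> 'a) \<Rightarrow> real \<Rightarrow> real \<times> real" where
  "best_pair S f' \<epsilon> =
     (THE p. p \<in> A3_pairs S f' \<and>
        (\<forall>r\<in>A3_pairs S f'. (fst p)\<^sup>2 + \<epsilon> * snd p \<le> (fst r)\<^sup>2 + \<epsilon> * snd r))"

definition Mbar :: "'a::euclidean_space set \<Rightarrow> ('a \<Rightarrow> 'a) \<Rightarrow> real \<Rightarrow> real" where
  "Mbar S f' \<epsilon> = fst (best_pair S f' \<epsilon>)"

definition Lbar :: "'a::euclidean_space set \<Rightarrow> ('a \<Rightarrow> 'a) \<Rightarrow> real \<Rightarrow> real" where
  "Lbar S f' \<epsilon> = snd (best_pair S f' \<epsilon>)"

definition T_eps :: "'a::euclidean_space set \<Rightarrow> ('a \<Rightarrow> 'a) \<Rightarrow> real \<Rightarrow> real" where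
  "T_eps S f' \<epsilon> = sqrt ((Mbar S f' \<epsilon>)\<^sup>2 + \<epsilon> * Lbar S f' \<epsilon>)"


section \<open>The QCC framework\<close>

definition initial_model ::
  "real \<Rightarrow> ('a::euclidean_space \<Rightarrow> ereal) \<Rightarrow> ('a \<Rightarrow> ereal) \<Rightarrow> ('a \<Rightarrow> 'a) \<Rightarrow>
   'a \<Rightarrow> ('a \<Rightarrow> ereal) \<Rightarrow> bool" where
  "initial_model \<mu> ft ht ft' x\<^sub>0 \<Gamma>\<^sub>1 \<longleftrightarrow>
     \<Gamma>\<^sub>1 \<in> Conv \<mu> \<and>
     (\<forall>u. q_model \<mu> ft ft' u x\<^sub>0 + ht u \<le> \<Gamma>\<^sub>1 u \<and> \<Gamma>\<^sub>1 u \<le> objective ft ht u)"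

definition model_update ::
  "real \<Rightarrow> ('a::euclidean_space \<Rightarrow> ereal) \<Rightarrow> ('a \<Rightarrow> ereal) \<Rightarrow> ('a \<Rightarrow> 'a) \<Rightarrow> real \<Rightarrow>
   ('a \<Rightarrow> ereal) \<Rightarrow> 'a \<Rightarrow> ('a \<Rightarrow> ereal) \<Rightarrow> bool" where
  "model_update \<mu> ft ht ft' \<tau> \<Gamma> x \<Gamma>' \<longleftrightarrow>
     \<Gamma>' \<in> Conv \<mu> \<and>
     (\<exists>\<Gamma>b \<in> Conv \<mu>.
        \<Gamma>b x = \<Gamma> x \<and> Argmin \<Gamma>b UNIV = {x} \<and>
        (\<forall>u. ereal \<tau> * \<Gamma>b u + ereal (1 - \<tau>) * (q_model \<mu> ft ft' u x + ht u) \<le> \<Gamma>' u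
             \<and> \<Gamma>' u \<le> objective ft ht u))"

text \<open>A run consists of the models \<open>\<Gamma> j\<close> (\<open>j \<ge> 1\<close>; \<open>\<Gamma> 0\<close> is unconstrained) and the iterates
  \<open>x j\<close>, \<open>y j\<close> (\<open>j \<ge> 0\<close>). The framework has no stopping test, so runs are infinite.\<close>

definition qcc_run ::
  "real \<Rightarrow> ('a::euclidean_space \<Rightarrow> ereal) \<Rightarrow> ('a \<Rightarrow> ereal) \<Rightarrow> ('a \<Rightarrow> 'a) \<Rightarrow> real \<Rightarrow>
   (nat \<Rightarrow> 'a \<Rightarrow> ereal) \<Rightarrow> (nat \<Rightarrow> 'a) \<Rightarrow> (nat \<Rightarrow> 'a) \<Rightarrow> bool" where
  "qcc_run \<mu> ft ht ft' \<tau> \<Gamma> x y \<longleftrightarrow>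
     0 < \<tau> \<and> \<tau> < 1 \<and> x 0 \<in> edom (h_part \<mu> ht) \<and> y 0 = x 0 \<and>
     initial_model \<mu> ft ht ft' (x 0) (\<Gamma> 1) \<and>
     (\<forall>j\<ge>2. model_update \<mu> ft ht ft' \<tau> (\<Gamma> (j - 1)) (x (j - 1)) (\<Gamma> j)) \<and>
     (\<forall>j\<ge>1. Argmin (\<Gamma> j) UNIV = {x j} \<and> y j \<in> Argmin (objective ft ht) (x ` {0..j}))"

definition qcc_m :: "(nat \<Rightarrow> 'a \<Rightarrow> ereal) \<Rightarrow> (nat \<Rightarrow> 'a) \<Rightarrow> nat \<Rightarrow> ereal" where
  "qcc_m \<Gamma> x j = \<Gamma> j (x j)"

definition qcc_t ::
  "('a \<Rightarrow> ereal) \<Rightarrow> (nat \<Rightarrow> 'a \<Rightarrow> ereal) \<Rightarrow> (nat \<Rightarrow> 'a) \<Rightarrow> (nat \<Rightarrow> 'a) \<Rightarrow> nat \<Rightarrow> ereal" where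
  "qcc_t \<phi> \<Gamma> x y j = \<phi> (y j) - qcc_m \<Gamma> x j"

text \<open>Reading of "at most \<open>N\<close> iterations" for a real bound \<open>N\<close>: iterations are numbered from 1, so
  \<open>N\<close> is rounded up to an integer, and at least one iteration is allowed. (Rounding down instead
  would make the complexity claim false: for large \<open>\<mu>\<close> there are runs with \<open>1 < N < 2\<close> in which
  \<open>y 1\<close> is not \<open>\<epsilon>\<close>-optimal.)\<close>

definition finds_eps_optimal_within :: "('a \<Rightarrow> ereal) \<Rightarrow> real \<Rightarrow> (nat \<Rightarrow> 'a) \<Rightarrow> real \<Rightarrow> bool" where
  "finds_eps_optimal_within \<phi> \<epsilon> y N \<longleftrightarrow>
     (\<exists>j\<ge>1. int j \<le> max 1 \<lceil>N\<rceil> \<and> eps_optimal \<phi> \<epsilon> (y j))"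

end

theory Submission
  imports Defs
begin

text \<open>The old model \<open>\<Gamma>b\<close> is \<open>\<mu>\<close>-convex with minimizer \<open>x j\<close>, so it grows by \<open>\<mu> / 2 * d\<^sup>2\<close> at distance
  \<open>d\<close> from \<open>x j\<close>, while the linearization of \<open>f\<close> at \<open>x j\<close> is wrong by at most
  \<open>2 * M * d + L / 2 * d\<^sup>2\<close> there. Evaluating the lower bound on the new model at its minimizer
  \<open>x (j + 1)\<close>, the choice of \<open>\<tau>\<close> gives \<open>t (j + 1) \<le> \<tau> * t j + (1 - \<tau>) * (\<epsilon> / 4)\<close>. Hence
  \<open>t j \<le> \<epsilon> / 4 + \<tau> ^ (j - 1) * t 1\<close>, where \<open>t 1 \<le> tbar\<close> by the same linearization error bound, and
  \<open>- ln \<tau> \<ge> 1 - \<tau>\<close> gives the iteration count. As \<open>\<Gamma> j \<le> \<phi>\<close>, the gap \<open>t j\<close> dominates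
  \<open>\<phi> (y j) - \<phi>\<^sub>*\<close>.\<close>

section \<open>Domains of convex functions and growth away from a minimizer\<close>

lemma edom_h_part: "edom (h_part \<mu> ht) = edom ht"
  by (auto simp: edom_def h_part_def)

lemma Conv_not_MInfty: "\<Psi> \<in> Conv \<mu> \<Longrightarrow> \<Psi> u \<noteq> -\<infinity>"
  by (simp add: Conv_def proper_def)

lemma Conv_finite_on_edom:
  assumes "\<Psi> \<in> Conv \<mu>" "u \<in> edom \<Psi>"
  obtains r where "\<Psi> u = ereal r"
  using assms Conv_not_MInfty[OF assms(1), of u] by (cases "\<Psi> u") (auto simp: edom_def)

lemma convex_edom:
  assumes "\<Psi> \<in> Conv \<mu>"
  shows "convex (edom \<Psi>)"
proof (rule convexI)
  fix a b :: 'a and s t :: real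
  assume a: "a \<in> edom \<Psi>" and b: "b \<in> edom \<Psi>" and "0 \<le> s" "0 \<le> t" "s + t = 1"
  then have t: "t = 1 - s" and s: "s \<in> {0..1}"
    by auto
  obtain p where p: "\<Psi> a = ereal p"
    using Conv_finite_on_edom[OF assms a] .
  obtain q where q: "\<Psi> b = ereal q"
    using Conv_finite_on_edom[OF assms b] .
  have "\<Psi> (s *\<^sub>R a + (1 - s) *\<^sub>R b) \<le> ereal s * \<Psi> a + ereal (1 - s) * \<Psi> b
      - ereal (s * (1 - s) * \<mu> / 2 * (norm (a - b))\<^sup>2)"
    using assms a b s unfolding Conv_def mu_convex_def by blast
  also have "\<dots> < \<infinity>"
    by (simp add: p q)
  finally show "s *\<^sub>R a + t *\<^sub>R b \<in> edom \<Psi>"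
    by (simp add: edom_def t)
qed

text \<open>Minimality is tested at the point of the segment with weight \<open>z\<close> on
  \<open>x\<close> and \<open>1 - z\<close> on \<open>u\<close>. Dividing the convexity inequality
  by \<open>1 - z\<close> leaves \<open>z * c \<le> b - a\<close>, and \<open>z\<close> tending to 1
  gives the full quadratic \<open>c\<close>.\<close>

lemma Argmin_growth:
  assumes "\<Psi> \<in> Conv \<mu>" "x \<in> Argmin \<Psi> UNIV"
  shows "\<Psi> x + ereal (\<mu> / 2 * (norm (u - x))\<^sup>2) \<le> \<Psi> u"
proof (cases "u \<in> edom \<Psi>")
  case False
  then show ?thesis
    by (simp add: edom_def)
next
  case u: True
  have min: "\<Psi> x \<le> \<Psi> v" for v
    using assms(2) by (simp add: Argmin_def)
  then have x: "x \<in> edom \<Psi>"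
    using u min[of u] by (auto simp: edom_def)
  obtain a where a: "\<Psi> x = ereal a"
    using Conv_finite_on_edom[OF assms(1) x] .
  obtain b where b: "\<Psi> u = ereal b"
    using Conv_finite_on_edom[OF assms(1) u] .
  define c where "c = \<mu> / 2 * (norm (u - x))\<^sup>2"
  have "z * c \<le> b - a" if z: "0 < z" "z < 1" for z
  proof -
    have z': "1 - z \<in> {0..1}"
      using z by simp
    have "ereal a \<le> \<Psi> ((1 - z) *\<^sub>R u + (1 - (1 - z)) *\<^sub>R x)"
      using min a by metis
    also have "\<dots> \<le> ereal (1 - z) * \<Psi> u + ereal (1 - (1 - z)) * \<Psi> x
        - ereal ((1 - z) * (1 - (1 - z)) * \<mu> / 2 * (norm (u - x))\<^sup>2)"
      using assms(1) u x z' unfolding Conv_def mu_convex_def by blast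
    finally have "a \<le> (1 - z) * b + z * a - (1 - z) * z * c"
      by (simp add: a b c_def)
    then have "(1 - z) * (z * c) \<le> (1 - z) * (b - a)"
      by (simp add: algebra_simps)
    then show ?thesis
      using z by simp
  qed
  then have "c \<le> b - a"
    by (rule field_le_mult_one_interval)
  then show ?thesis
    by (simp add: a b c_def)
qed

section \<open>Linearization error under the hybrid bound (A3)\<close>

text \<open>Telescoping over \<open>n\<close> equal steps from \<open>v\<close> to \<open>u\<close> replaces integrating the subgradient along
  the segment; letting \<open>n\<close> tend to infinity removes the last summand.\<close>

lemma telescoped_subgradient_bound:
  fixes F :: "'a::real_inner \<Rightarrow> real" and G :: "'a \<Rightarrow> 'a"
  assumes S: "convex S" "u \<in> S" "v \<in> S"
    and sub: "\<And>a b. a \<in> S \<Longrightarrow> b \<in> S \<Longrightarrow> F a + G a \<bullet> (b - a) \<le> F b"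
    and var: "\<And>a b. a \<in> S \<Longrightarrow> b \<in> S \<Longrightarrow> norm (G a - G b) \<le> 2 * M + L * norm (a - b)"
    and n: "n > 0"
  shows "F u - F v - G v \<bullet> (u - v)
    \<le> 2 * M * norm (u - v) + L / 2 * (norm (u - v))\<^sup>2 + L / 2 * (norm (u - v))\<^sup>2 / real n"
proof -
  define d where "d = norm (u - v)"
  define p where "p k = v + (real k / real n) *\<^sub>R (u - v)" for k
  have p_in: "p k \<in> S" if "k \<le> n" for k
  proof -
    have "(1 - real k / real n) *\<^sub>R v + (real k / real n) *\<^sub>R u \<in> S"
      using S that n by (intro convexD) (auto simp: field_simps)
    then show ?thesis
      by (simp add: p_def algebra_simps)
  qed
  have step: "F (p (Suc k)) - F (p k)
      \<le> G v \<bullet> (u - v) / n + 2 * M * d / n + L * d\<^sup>2 * (k + 1) / n\<^sup>2" if k: "k < n" for k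
  proof -
    have diff: "p (Suc k) - p k = (1 / real n) *\<^sub>R (u - v)"
      by (simp add: p_def add_divide_distrib scaleR_add_left)
    \<comment> \<open>The subgradient at the new point, looking backwards, bounds the increment from
      above. It is then compared with \<open>G v\<close> rather than with \<open>G (p k)\<close>:
      the jump \<open>2 * M\<close> is paid once per step of length \<open>d / n\<close>, while
      comparing consecutive points would accumulate it.\<close>
    have "F (p (Suc k)) + G (p (Suc k)) \<bullet> (p k - p (Suc k)) \<le> F (p k)"
      using k by (intro sub p_in) auto
    then have "F (p (Suc k)) - F (p k) \<le> G (p (Suc k)) \<bullet> (p (Suc k) - p k)"
      by (simp add: inner_diff_right)
    also have "\<dots> = (G v \<bullet> (u - v) + (G (p (Suc k)) - G v) \<bullet> (u - v)) / n"
      by (simp add: diff inner_diff_left)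
    also have "(G (p (Suc k)) - G v) \<bullet> (u - v) \<le> norm (G (p (Suc k)) - G v) * d"
      unfolding d_def by (rule norm_cauchy_schwarz)
    also have "\<dots> \<le> (2 * M + L * norm (p (Suc k) - v)) * d"
      using k S by (intro mult_right_mono var p_in) (auto simp: d_def)
    also have "norm (p (Suc k) - v) = (k + 1) / n * d"
      by (simp add: p_def d_def)
    also have "(G v \<bullet> (u - v) + (2 * M + L * ((k + 1) / n * d)) * d) / n
        = G v \<bullet> (u - v) / n + 2 * M * d / n + L * d\<^sup>2 * (k + 1) / n\<^sup>2"
      using n by (simp add: field_simps power2_eq_square)
    finally show ?thesis
      using n by (simp add: divide_right_mono)
  qed
  \<comment> \<open>The distances from \<open>v\<close> are \<open>(k + 1) / n * d\<close>, with
    mean \<open>(1 / 2 + 1 / (2 * n)) * d\<close>. The first half is the Taylor coefficient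
    \<open>L / 2\<close>, the second the discretization error.\<close>
  have sum_id: "(\<Sum>k<n. real k + 1) = real n * (real n + 1) / 2" for n
    by (induction n) (auto simp: field_simps)
  have "F u - F v = F (p n) - F (p 0)"
    using n by (simp add: p_def)
  also have "\<dots> = (\<Sum>k<n. F (p (Suc k)) - F (p k))"
    by (rule sum_lessThan_telescope[symmetric])
  also have "\<dots> \<le> (\<Sum>k<n. (G v \<bullet> (u - v) / n + 2 * M * d / n) + L * d\<^sup>2 / n\<^sup>2 * (real k + 1))"
    using step by (intro sum_mono) (auto simp: algebra_simps)
  also have "\<dots> = n * (G v \<bullet> (u - v) / n + 2 * M * d / n)
      + L * d\<^sup>2 / n\<^sup>2 * (real n * (real n + 1) / 2)"
    by (subst sum.distrib) (simp only: sum_id sum_constant card_lessThan flip: sum_distrib_left)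
  also have "n * (G v \<bullet> (u - v) / n + 2 * M * d / n) = G v \<bullet> (u - v) + 2 * M * d"
    using n by (simp add: distrib_left)
  also have "L * d\<^sup>2 / n\<^sup>2 * (real n * (real n + 1) / 2) = L / 2 * d\<^sup>2 + L / 2 * d\<^sup>2 / n"
    using n by (simp add: field_simps power2_eq_square)
  finally show ?thesis
    by (simp add: d_def)
qed

lemma linearization_error_bound:
  fixes F :: "'a::real_inner \<Rightarrow> real" and G :: "'a \<Rightarrow> 'a"
  assumes "convex S" "u \<in> S" "v \<in> S"
    and "\<And>a b. a \<in> S \<Longrightarrow> b \<in> S \<Longrightarrow> F a + G a \<bullet> (b - a) \<le> F b"
    and "\<And>a b. a \<in> S \<Longrightarrow> b \<in> S \<Longrightarrow> norm (G a - G b) \<le> 2 * M + L * norm (a - b)"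
  shows "F u - F v - G v \<bullet> (u - v) \<le> 2 * M * norm (u - v) + L / 2 * (norm (u - v))\<^sup>2"
proof (rule LIMSEQ_le_const)
  let ?B = "2 * M * norm (u - v) + L / 2 * (norm (u - v))\<^sup>2"
  show "(\<lambda>n. ?B + L / 2 * (norm (u - v))\<^sup>2 / real n) \<longlonglongrightarrow> ?B"
    using tendsto_add[OF tendsto_const[of ?B] lim_const_over_n[of "L / 2 * (norm (u - v))\<^sup>2"]]
    by (simp only: add_0_right)
  show "\<exists>N. \<forall>n\<ge>N. F u - F v - G v \<bullet> (u - v) \<le> ?B + L / 2 * (norm (u - v))\<^sup>2 / real n"
    using telescoped_subgradient_bound[OF assms] by (intro exI[of _ 1]) auto
qed

section \<open>Existence and uniqueness of the optimal pair of constants\<close>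

lemma closed_A3_pairs: "closed (A3_pairs S G)"
proof -
  have "A3_pairs S G = {p. 0 \<le> fst p} \<inter> {p. 0 \<le> snd p} \<inter>
      (\<Inter>u\<in>S. \<Inter>v\<in>S. {p. norm (G u - G v) \<le> 2 * fst p + snd p * norm (u - v)})"
    by (auto simp: A3_pairs_def)
  moreover have "closed \<dots>"
    by (intro closed_Int closed_INT ballI closed_Collect_le continuous_intros)
  ultimately show ?thesis
    by simp
qed

lemma A3_pairs_midpoint:
  assumes "p \<in> A3_pairs S G" "q \<in> A3_pairs S G"
  shows "((fst p + fst q) / 2, (snd p + snd q) / 2) \<in> A3_pairs S G"
proof -
  have "norm (G u - G v) \<le> 2 * ((fst p + fst q) / 2) + (snd p + snd q) / 2 * norm (u - v)"
    if "u \<in> S" "v \<in> S" for u v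
  proof -
    have "norm (G u - G v) \<le> 2 * fst p + snd p * norm (u - v)"
      "norm (G u - G v) \<le> 2 * fst q + snd q * norm (u - v)"
      using assms that by (auto simp: A3_pairs_def)
    then show ?thesis
      by (simp add: field_simps)
  qed
  then show ?thesis
    using assms by (auto simp: A3_pairs_def)
qed

text \<open>The \<open>THE\<close> in \<open>best_pair\<close> carries information only once a
  unique minimizer is known. Existence is compactness of a sublevel set. For uniqueness, the
  midpoint of two minimizers is feasible and lowers the objective by
  \<open>((fst p - fst q) / 2)\<^sup>2\<close>, so the first components agree; equal objective
  values and \<epsilon> > 0 then force equal second components.\<close>

lemma best_pair_in_A3_pairs:
  assumes "assumption_A3 S G" "\<epsilon> > 0"
  shows "best_pair S G \<epsilon> \<in> A3_pairs S G"
proof -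
  define J :: "real \<times> real \<Rightarrow> real" where "J p = (fst p)\<^sup>2 + \<epsilon> * snd p" for p
  define Q where "Q p \<longleftrightarrow> p \<in> A3_pairs S G \<and> (\<forall>r\<in>A3_pairs S G. J p \<le> J r)" for p
  obtain r0 where r0: "r0 \<in> A3_pairs S G"
    using assms(1) by (auto simp: assumption_A3_def)
  have nonneg: "0 \<le> fst p" "0 \<le> snd p" if "p \<in> A3_pairs S G" for p
    using that by (auto simp: A3_pairs_def)
  \<comment> \<open>Both summands of \<open>J\<close> are nonnegative on feasible pairs, so
    \<open>J r \<le> J r0\<close> confines \<open>r\<close> to this box.\<close>
  define K where "K = A3_pairs S G \<inter> ({0..sqrt (J r0)} \<times> {0..J r0 / \<epsilon>})"
  have K: "r \<in> K" if r: "r \<in> A3_pairs S G" "J r \<le> J r0" for r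
  proof -
    have "(fst r)\<^sup>2 \<le> J r" "\<epsilon> * snd r \<le> J r"
      using nonneg[OF r(1)] assms(2) by (auto simp: J_def)
    then have "fst r \<le> sqrt (J r0)" "snd r \<le> J r0 / \<epsilon>"
      using r(2) assms(2) by (auto simp: real_le_rsqrt pos_le_divide_eq mult.commute)
    then show ?thesis
      using r nonneg[OF r(1)] by (auto simp: K_def mem_Times_iff)
  qed
  have "compact K"
    unfolding K_def by (intro closed_Int_compact closed_A3_pairs compact_Times compact_Icc)
  moreover have "K \<noteq> {}"
    using K[OF r0] by auto
  moreover have "continuous_on K J"
    unfolding J_def by (intro continuous_intros)
  ultimately obtain p where p: "p \<in> K" "\<And>r. r \<in> K \<Longrightarrow> J p \<le> J r"
    using continuous_attains_inf by metis
  have "Q p"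
    unfolding Q_def
  proof (intro conjI ballI)
    show "p \<in> A3_pairs S G"
      using p(1) by (simp add: K_def)
    fix r assume r: "r \<in> A3_pairs S G"
    show "J p \<le> J r"
      using p(2)[OF K[OF r]] p(2)[OF K[OF r0]] by (cases "J r \<le> J r0") auto
  qed
  moreover have "q = p" if q: "Q q" for q
  proof -
    have "J q = J p"
      using q \<open>Q p\<close> by (auto simp: Q_def intro!: antisym)
    moreover have "J p \<le> J ((fst p + fst q) / 2, (snd p + snd q) / 2)"
      using q \<open>Q p\<close> by (auto simp: Q_def intro!: A3_pairs_midpoint)
    moreover have "J ((fst p + fst q) / 2, (snd p + snd q) / 2)
        = (J p + J q) / 2 - ((fst p - fst q) / 2)\<^sup>2"
      by (simp add: J_def field_simps power2_eq_square)
    ultimately have "((fst p - fst q) / 2)\<^sup>2 \<le> 0"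
      by simp
    then have "fst p = fst q"
      by simp
    with \<open>J q = J p\<close> assms(2) have "snd p = snd q"
      by (simp add: J_def)
    with \<open>fst p = fst q\<close> show ?thesis
      by (simp add: prod_eq_iff)
  qed
  ultimately have "Q (THE p. Q p)"
    by (rule theI)
  then show ?thesis
    by (simp add: Q_def J_def best_pair_def)
qed

section \<open>From the error bound for \<open>f\<close> to the model of the objective\<close>

lemma objective_le_q_model:
  assumes "assumption_A1 \<mu> (f_part \<mu> ft) (h_part \<mu> ht) (f_oracle \<mu> ft')"
    and comp: "composite_problem \<mu> ft ht ft'"
    and pair: "(M, L) \<in> A3_pairs (edom ht) (f_oracle \<mu> ft')"
    and u: "u \<in> edom ht" and v: "v \<in> edom ht"
  shows "objective ft ht u \<le> q_model \<mu> ft ft' u v + ht u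
    + ereal (2 * M * norm (u - v) + L / 2 * (norm (u - v))\<^sup>2)"
proof -
  \<comment> \<open>Real-valued stand-in for \<open>f\<close>, meaningful on \<open>edom ht\<close>,
    where \<open>ft\<close> is finite; \<open>real_of_ereal\<close> sends infinite values to
    0.\<close>
  define F where "F a = real_of_ereal (ft a) - \<mu> / 2 * (norm a)\<^sup>2" for a
  let ?G = "f_oracle \<mu> ft'"
  have ft: "ft a = ereal (F a + \<mu> / 2 * (norm a)\<^sup>2)" if "a \<in> edom ht" for a
    using that comp Conv_finite_on_edom[of ft \<mu> a]
    by (force simp: composite_problem_def F_def)
  have "F a + ?G a \<bullet> (b - a) \<le> F b" if a: "a \<in> edom ht" and b: "b \<in> edom ht" for a b
  proof -
    have "f_part \<mu> ft a + ereal (?G a \<bullet> (b - a)) \<le> f_part \<mu> ft b"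
      using assms(1) a by (auto simp: assumption_A1_def subdifferential_def edom_h_part)
    then show ?thesis
      by (simp add: f_part_def ft a b)
  qed
  moreover have "norm (?G a - ?G b) \<le> 2 * M + L * norm (a - b)"
    if "a \<in> edom ht" "b \<in> edom ht" for a b
    using pair that by (auto simp: A3_pairs_def)
  moreover have "convex (edom ht)"
    using comp convex_edom by (auto simp: composite_problem_def)
  ultimately have *: "F u - F v - ?G v \<bullet> (u - v)
      \<le> 2 * M * norm (u - v) + L / 2 * (norm (u - v))\<^sup>2"
    using u v by (intro linearization_error_bound)
  \<comment> \<open>The linearization error of the quadratic moved between the two summands is
    exactly the quadratic term of \<open>q_model\<close>, so the error of \<open>f\<close> and its
    linear model equals that of \<open>ft\<close> and its quadratic model.\<close>
  have "\<mu> / 2 * (norm u)\<^sup>2 - \<mu> / 2 * (norm v)\<^sup>2 - \<mu> * (v \<bullet> (u - v)) = \<mu> / 2 * (norm (u - v))\<^sup>2"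
    by (simp add: power2_norm_eq_inner inner_diff_left inner_diff_right inner_commute field_simps)
  with * have "F u + \<mu> / 2 * (norm u)\<^sup>2 \<le> F v + \<mu> / 2 * (norm v)\<^sup>2 + ft' v \<bullet> (u - v)
      + \<mu> / 2 * (norm (u - v))\<^sup>2 + (2 * M * norm (u - v) + L / 2 * (norm (u - v))\<^sup>2)"
    by (simp add: f_oracle_def inner_diff_left)
  moreover obtain r where "ht u = ereal r"
    using comp u Conv_finite_on_edom[of ht 0 u] by (auto simp: composite_problem_def)
  ultimately show ?thesis
    by (simp add: objective_def q_model_def ft u v)
qed

section \<open>The choice of \<tau> and the resulting recursion\<close>

text \<open>Division-free form of the choice of \<tau>, taken with
  \<open>a = 8 * (M\<^sup>2 + \<epsilon> * L)\<close> and \<open>c = \<mu> * \<epsilon>\<close>. It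
  serves both the calibration below and the identification of the factor in the iteration bound with
  \<open>1 / (1 - \<tau>)\<close>.\<close>

lemma tau_relation:
  fixes a c \<tau> :: real
  assumes "a > 0" "\<tau> > 0" "1 / \<tau> = 1 + c / a"
  shows "\<tau> * c = (1 - \<tau>) * a"
proof -
  have "a = a * \<tau> * (1 / \<tau>)"
    using \<open>\<tau> > 0\<close> by simp
  also have "\<dots> = a * \<tau> * (1 + c / a)"
    by (simp only: assms(3))
  also have "\<dots> = a * \<tau> + \<tau> * c"
    using \<open>a > 0\<close> by (simp add: field_simps)
  finally show ?thesis
    by algebra
qed

text \<open>This is where the value of \<open>\<tau>\<close> comes from: the growth \<open>\<tau> * (\<mu> / 2 * d\<^sup>2)\<close> of the strongly
  convex old model absorbs the error of the new linearization at distance \<open>d\<close>, up to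
  \<open>(1 - \<tau>) * (\<epsilon> / 4)\<close>.\<close>

lemma tau_calibration:
  fixes \<mu> \<epsilon> \<tau> M L d :: real
  assumes "\<mu> > 0" "\<epsilon> > 0" "L \<ge> 0" "M\<^sup>2 + \<epsilon> * L > 0" "\<tau> > 0"
    and \<tau>: "1 / \<tau> = 1 + \<mu> * \<epsilon> / (8 * (M\<^sup>2 + \<epsilon> * L))"
  shows "(1 - \<tau>) * (2 * M * d + L / 2 * d\<^sup>2) \<le> \<tau> * (\<mu> / 2 * d\<^sup>2) + (1 - \<tau>) * (\<epsilon> / 4)"
proof -
  define A where "A = M\<^sup>2 + \<epsilon> * L"
  have "A > 0"
    using assms by (simp add: A_def)
  have rel: "\<tau> * (\<mu> * \<epsilon>) = (1 - \<tau>) * (8 * A)"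
    using tau_relation[of "8 * A" \<tau> "\<mu> * \<epsilon>"] \<open>A > 0\<close> \<open>\<tau> > 0\<close> \<tau> by (simp add: A_def)
  then have pos: "1 - \<tau> > 0"
    using assms(1,2,5) \<open>A > 0\<close>
    by (metis mult_pos_pos zero_less_mult_pos2 mult_numeral_1 zero_less_numeral)
  \<comment> \<open>The square absorbs the term linear in \<open>d\<close>: it expands to \<open>4 *
    M\<^sup>2 * d\<^sup>2 - 2 * M * d * \<epsilon> + \<epsilon>\<^sup>2 / 4\<close>, the source of
    \<epsilon> / 4. The rest is the surplus of \<open>4 * \<epsilon> * L\<close> over
    \<open>\<epsilon> * L / 2\<close>.\<close>
  have "0 \<le> (4 * M * d - \<epsilon>)\<^sup>2 / 4 + 7 / 2 * \<epsilon> * L * d\<^sup>2"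
    using assms by simp
  then have "\<epsilon> * (2 * M * d + L / 2 * d\<^sup>2) \<le> 4 * A * d\<^sup>2 + \<epsilon> * (\<epsilon> / 4)"
    by (simp add: A_def field_simps power2_eq_square)
  then have "(1 - \<tau>) * (\<epsilon> * (2 * M * d + L / 2 * d\<^sup>2)) \<le> (1 - \<tau>) * (4 * A * d\<^sup>2 + \<epsilon> * (\<epsilon> / 4))"
    using pos by (intro mult_left_mono) auto
  also have "\<dots> = (1 - \<tau>) * (8 * A) * (d\<^sup>2 / 2) + \<epsilon> * ((1 - \<tau>) * (\<epsilon> / 4))"
    by (simp add: algebra_simps)
  also have "\<dots> = \<epsilon> * (\<tau> * (\<mu> / 2 * d\<^sup>2) + (1 - \<tau>) * (\<epsilon> / 4))"
    unfolding rel[symmetric] by (simp add: algebra_simps)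
  finally have "\<epsilon> * ((1 - \<tau>) * (2 * M * d + L / 2 * d\<^sup>2))
      \<le> \<epsilon> * (\<tau> * (\<mu> / 2 * d\<^sup>2) + (1 - \<tau>) * (\<epsilon> / 4))"
    by (simp only: mult.left_commute)
  then show ?thesis
    using \<open>\<epsilon> > 0\<close> by simp
qed

text \<open>The affine recursion has fixed point \<epsilon> / 4, and the excess over it shrinks by
  \<tau> per iteration. The excess may still be 3 * \<epsilon> / 4 at the end, hence the argument
  \<open>4 * c / (3 * \<epsilon>)\<close> of the logarithm.\<close>

lemma contraction_reaches:
  fixes t :: "nat \<Rightarrow> real"
  assumes "0 < \<tau>" "\<tau> < 1" "c > 0" "\<epsilon> > 0"
    and t1: "t 1 \<le> c"
    and step: "\<And>j. j \<ge> 1 \<Longrightarrow> t (Suc j) \<le> \<tau> * t j + (1 - \<tau>) * (\<epsilon> / 4)"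
    and j: "j \<ge> 1" "real j \<ge> 1 + ln (4 * c / (3 * \<epsilon>)) / (1 - \<tau>)"
  shows "t j \<le> \<epsilon>"
proof -
  have "t (Suc k) \<le> \<epsilon> / 4 + \<tau> ^ k * c" for k
  proof (induction k)
    case 0
    then show ?case
      using t1 \<open>\<epsilon> > 0\<close> by simp
  next
    case (Suc k)
    have "t (Suc (Suc k)) \<le> \<tau> * t (Suc k) + (1 - \<tau>) * (\<epsilon> / 4)"
      using step by simp
    also have "\<dots> \<le> \<tau> * (\<epsilon> / 4 + \<tau> ^ k * c) + (1 - \<tau>) * (\<epsilon> / 4)"
      using Suc \<open>0 < \<tau>\<close> by simp
    finally show ?case
      by (simp add: field_simps)
  qed
  from this[of "j - 1"] have "t j \<le> \<epsilon> / 4 + \<tau> ^ (j - 1) * c"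
    using j(1) by simp
  moreover have "\<tau> ^ (j - 1) * c \<le> 3 * \<epsilon> / 4"
  proof -
    have "ln (4 * c / (3 * \<epsilon>)) \<le> (1 - \<tau>) * real (j - 1)"
      using j \<open>\<tau> < 1\<close> by (simp add: field_simps of_nat_diff)
    also have "\<dots> \<le> - ln \<tau> * real (j - 1)"
      using ln_le_minus_one[OF \<open>0 < \<tau>\<close>] by (intro mult_right_mono) auto
    finally have "real (j - 1) * ln \<tau> + ln (4 * c / (3 * \<epsilon>)) \<le> 0"
      by (simp add: algebra_simps)
    then have "ln (\<tau> ^ (j - 1) * (4 * c / (3 * \<epsilon>))) \<le> 0"
      using assms by (subst ln_mult) (auto simp: ln_realpow)
    then have "\<tau> ^ (j - 1) * (4 * c / (3 * \<epsilon>)) \<le> 1"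
      using assms by (subst (asm) ln_le_zero_iff) auto
    then show ?thesis
      using \<open>\<epsilon> > 0\<close> by (simp add: field_simps)
  qed
  ultimately show ?thesis
    by simp
qed

section \<open>Analysis of a run\<close>

theorem theorem2p6:
  fixes \<mu> \<epsilon> \<tau> D M L T tbar N :: real
    and ft ht f h \<phi> :: "real ^ 'n \<Rightarrow> ereal"
    and ft' f' :: "real ^ 'n \<Rightarrow> real ^ 'n"
    and \<Gamma> :: "nat \<Rightarrow> real ^ 'n \<Rightarrow> ereal"
    and x y :: "nat \<Rightarrow> real ^ 'n"
  assumes "\<mu> > 0" and "\<epsilon> > 0"
    and "composite_problem \<mu> ft ht ft'"
    and "\<phi> = objective ft ht"
    and "f = f_part \<mu> ft" and "h = h_part \<mu> ht" and "f' = f_oracle \<mu> ft'"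
    and "assumption_A1 \<mu> f h f'"
    and "assumption_A2 \<phi>"
    and "assumption_A3 (edom h) f'"
    and "M = Mbar (edom h) f' \<epsilon>" and "L = Lbar (edom h) f' \<epsilon>" and "T = T_eps (edom h) f' \<epsilon>"
    and "T > 0"
    and "1 / \<tau> = 1 + \<mu> * \<epsilon> / (8 * T\<^sup>2)"
    and "qcc_run \<mu> ft ht ft' \<tau> \<Gamma> x y"
    and "bounded (edom h)" and "D = diameter (edom h)" and "D > 0"
    and "tbar = M\<^sup>2 + (L / 2 + 1) * D\<^sup>2"
    and "N = 1 + (1 + 8 * (M\<^sup>2 + \<epsilon> * L) / (\<mu> * \<epsilon>)) * ln (4 * tbar / (3 * \<epsilon>))"
  shows "(\<forall>j\<ge>1. real j \<ge> N \<longrightarrow> qcc_t \<phi> \<Gamma> x y j \<le> ereal \<epsilon>)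
       \<and> finds_eps_optimal_within \<phi> \<epsilon> y N"
proof -
  define S where "S = edom ht"
  have S: "edom h = S"
    by (simp add: S_def \<open>h = _\<close> edom_h_part)
  note comp = \<open>composite_problem \<mu> ft ht ft'\<close>
  have pair: "(M, L) \<in> A3_pairs S f'"
    using best_pair_in_A3_pairs[OF \<open>assumption_A3 (edom h) f'\<close> \<open>\<epsilon> > 0\<close>] assms(11,12)
    by (simp add: Mbar_def Lbar_def S)
  then have "L \<ge> 0"
    by (auto simp: A3_pairs_def)
  have nonneg: "0 \<le> M\<^sup>2 + \<epsilon> * L"
    using \<open>L \<ge> 0\<close> \<open>\<epsilon> > 0\<close> by simp
  then have T2: "T\<^sup>2 = M\<^sup>2 + \<epsilon> * L"
    using assms(11-13) by (simp add: T_eps_def)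
  then have T2pos: "M\<^sup>2 + \<epsilon> * L > 0"
    using \<open>T > 0\<close> by (metis zero_less_power)
  have \<tau>: "0 < \<tau>" "\<tau> < 1"
    and x0: "x 0 \<in> S"
    and init: "initial_model \<mu> ft ht ft' (x 0) (\<Gamma> 1)"
    and upd: "\<And>j. j \<ge> 1 \<Longrightarrow> model_update \<mu> ft ht ft' \<tau> (\<Gamma> j) (x j) (\<Gamma> (Suc j))"
    and xmin: "\<And>j. j \<ge> 1 \<Longrightarrow> x j \<in> Argmin (\<Gamma> j) UNIV"
    and ymin: "\<And>j. j \<ge> 1 \<Longrightarrow> y j \<in> Argmin \<phi> (x ` {0..j})"
    using \<open>qcc_run _ _ _ _ _ _ _ _\<close> \<open>\<phi> = _\<close>
    by (auto simp: qcc_run_def S_def edom_h_part dest: spec[of _ "Suc _"])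
  have \<tau>eq: "1 / \<tau> = 1 + \<mu> * \<epsilon> / (8 * (M\<^sup>2 + \<epsilon> * L))"
    using assms(15) T2 by simp
  have dist_le: "norm (u - v) \<le> D" if "u \<in> S" "v \<in> S" for u v
    using diameter_bounded_bound[OF \<open>bounded (edom h)\<close>, of u v] that
    by (simp add: S \<open>D = _\<close> dist_norm)
  have ft_ninf: "ft u \<noteq> -\<infinity>" and ht_ninf: "ht u \<noteq> -\<infinity>" for u
    using comp Conv_not_MInfty by (auto simp: composite_problem_def)
  have \<phi>_fin: "\<exists>r. \<phi> u = ereal r" if "u \<in> S" for u
  proof -
    have "u \<in> edom ft" "u \<in> edom ht"
      using that comp by (auto simp: composite_problem_def S_def)
    then show ?thesis
      using ft_ninf[of u] ht_ninf[of u] unfolding \<open>\<phi> = _\<close> objective_def edom_def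
      by (cases "ft u"; cases "ht u") auto
  qed
  have q_bound: "\<phi> u \<le> q_model \<mu> ft ft' u v + ht u
      + ereal (2 * M * norm (u - v) + L / 2 * (norm (u - v))\<^sup>2)" if "u \<in> S" "v \<in> S" for u v
    using objective_le_q_model[of \<mu> ft ht ft' M L u v] that comp pair assms(4-8)
    by (simp add: S_def)
  have \<Gamma>_Conv: "\<Gamma> j \<in> Conv \<mu>" and \<Gamma>_le: "\<Gamma> j u \<le> \<phi> u" if "j \<ge> 1" for j u
  proof -
    have "\<Gamma> j \<in> Conv \<mu> \<and> (\<forall>u. \<Gamma> j u \<le> \<phi> u)"
      using that
    proof (induction j rule: nat_induct_at_least)
      case base
      then show ?case
        using init \<open>\<phi> = _\<close> by (simp add: initial_model_def)
    next
      case (Suc j)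
      then show ?case
        using upd[of j] \<open>\<phi> = _\<close> by (auto simp: model_update_def)
    qed
    then show "\<Gamma> j \<in> Conv \<mu>" "\<Gamma> j u \<le> \<phi> u"
      by auto
  qed
  have xmin_le: "\<Gamma> j (x j) \<le> \<Gamma> j u" if "j \<ge> 1" for j u
    using xmin[OF that] by (simp add: Argmin_def)
  \<comment> \<open>The minimal value of the model is at most its value at \<open>x 0\<close>, hence
    at most the finite \<open>\<phi> (x 0)\<close>.\<close>
  have \<Gamma>_fin: "\<exists>r. \<Gamma> j (x j) = ereal r" if "j \<ge> 1" for j
  proof -
    obtain r where "\<phi> (x 0) = ereal r"
      using \<phi>_fin[OF x0] by auto
    then have "\<Gamma> j (x j) \<le> ereal r"
      using xmin_le[OF that, of "x 0"] \<Gamma>_le[OF that, of "x 0"] by (metis order_trans)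
    then show ?thesis
      using Conv_not_MInfty[OF \<Gamma>_Conv[OF that], of "x j"] by (cases "\<Gamma> j (x j)") auto
  qed
  have q_ninf: "q_model \<mu> ft ft' u v \<noteq> -\<infinity>" for u v
    using ft_ninf[of v] by (auto simp: q_model_def)
  \<comment> \<open>The lower bound on each model contains \<open>ht\<close> with positive weight, 1
    initially and \<open>1 - \<tau>\<close> afterwards, and no other summand is minus infinity. An
    iterate outside the domain would therefore make the finite minimum
    \<open>\<Gamma> j (x j)\<close> infinite.\<close>
  have xS: "x j \<in> S" for j
  proof (cases "j = 0")
    case True
    then show ?thesis using x0 by simp
  next
    case False
    then have j: "j \<ge> 1" by simp
    obtain r where r: "\<Gamma> j (x j) = ereal r"
      using \<Gamma>_fin[OF j] by auto
    have "ht (x j) \<noteq> \<infinity>"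
    proof (cases "j = 1")
      case True
      have "q_model \<mu> ft ft' (x j) (x 0) + ht (x j) \<le> ereal r"
        using init unfolding initial_model_def True r[unfolded True, symmetric] by blast
      then show ?thesis
        using q_ninf[of "x j" "x 0"] by auto
    next
      case False
      with j obtain k where k: "j = Suc k" "k \<ge> 1"
        by (cases j) auto
      then obtain \<Gamma>b where "\<Gamma>b \<in> Conv \<mu>" and
        "ereal \<tau> * \<Gamma>b (x j) + ereal (1 - \<tau>) * (q_model \<mu> ft ft' (x j) (x k) + ht (x j))
          \<le> \<Gamma> j (x j)"
        using upd[of k] by (auto simp: model_update_def)
      then show ?thesis
        using q_ninf[of "x j" "x k"] Conv_not_MInfty[of \<Gamma>b \<mu> "x j"] \<tau> r
        by (cases "\<Gamma>b (x j)"; cases "q_model \<mu> ft ft' (x j) (x k)") auto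
    qed
    then show ?thesis
      by (auto simp: S_def edom_def)
  qed
  define m where "m j = real_of_ereal (\<Gamma> j (x j))" for j
  define w where "w j = real_of_ereal (\<phi> (x j))" for j
  define v where "v j = real_of_ereal (\<phi> (y j))" for j
  have m: "\<Gamma> j (x j) = ereal (m j)" if "j \<ge> 1" for j
    using \<Gamma>_fin[OF that] by (auto simp: m_def)
  have w: "\<phi> (x j) = ereal (w j)" for j
    using \<phi>_fin[OF xS[of j]] by (auto simp: w_def)
  have v: "\<phi> (y j) = ereal (v j)" if "j \<ge> 1" for j
    using ymin[OF that] w by (auto simp: Argmin_def v_def)
  have v_le: "v j \<le> w i" if "j \<ge> 1" "i \<le> j" for i j
  proof -
    have "\<phi> (y j) \<le> \<phi> (x i)"
      using ymin[OF that(1)] that(2) by (auto simp: Argmin_def)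
    then show ?thesis
      using v[OF that(1)] w[of i] by simp
  qed
  have v_decr: "v (Suc j) \<le> v j" if "j \<ge> 1" for j
  proof -
    have "y j \<in> x ` {0..Suc j}"
      using ymin[OF that] by (auto simp: Argmin_def)
    then have "\<phi> (y (Suc j)) \<le> \<phi> (y j)"
      using ymin[of "Suc j"] by (auto simp: Argmin_def)
    then show ?thesis
      using v[OF that] v[of "Suc j"] by simp
  qed
  define t where "t j = v j - m j" for j
  have t: "qcc_t \<phi> \<Gamma> x y j = ereal (t j)" if "j \<ge> 1" for j
    by (simp add: qcc_t_def qcc_m_def m[OF that] v[OF that] t_def)
  have t1: "t 1 \<le> tbar"
  proof -
    define d where "d = norm (x 1 - x 0)"
    have "0 \<le> d" "d \<le> D"
      using dist_le[OF xS xS] by (auto simp: d_def)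
    have "ereal (w 1) \<le> q_model \<mu> ft ft' (x 1) (x 0) + ht (x 1)
        + ereal (2 * M * d + L / 2 * d\<^sup>2)"
      using q_bound[OF xS xS, of 1 0] by (simp add: w d_def)
    also have "\<dots> \<le> \<Gamma> 1 (x 1) + ereal (2 * M * d + L / 2 * d\<^sup>2)"
      using init by (intro add_right_mono) (auto simp: initial_model_def)
    finally have "w 1 \<le> m 1 + (2 * M * d + L / 2 * d\<^sup>2)"
      by (simp add: m)
    \<comment> \<open>This splitting of the mixed term produces the \<open>M\<^sup>2\<close> and the
      \<open>+ 1\<close> in \<open>tbar\<close>.\<close>
    moreover have "2 * M * d \<le> M\<^sup>2 + d\<^sup>2"
      using zero_le_power2[of "M - d"] by (simp add: power2_diff)
    moreover have "L / 2 * d\<^sup>2 + d\<^sup>2 \<le> (L / 2 + 1) * D\<^sup>2"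
      using mult_left_mono[OF power_mono[OF \<open>d \<le> D\<close> \<open>0 \<le> d\<close>, of 2], of "L / 2 + 1"] \<open>L \<ge> 0\<close>
      by (simp add: algebra_simps)
    ultimately show ?thesis
      using v_le[of 1 1] by (simp add: t_def \<open>tbar = _\<close>)
  qed
  have step: "t (Suc j) \<le> \<tau> * t j + (1 - \<tau>) * (\<epsilon> / 4)" if j: "j \<ge> 1" for j
  proof -
    define d where "d = norm (x (Suc j) - x j)"
    define B where "B = 2 * M * d + L / 2 * d\<^sup>2"
    define Q where "Q = q_model \<mu> ft ft' (x (Suc j)) (x j) + ht (x (Suc j))"
    obtain \<Gamma>b where \<Gamma>b: "\<Gamma>b \<in> Conv \<mu>" "\<Gamma>b (x j) = \<Gamma> j (x j)" "x j \<in> Argmin \<Gamma>b UNIV"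
      and le: "ereal \<tau> * \<Gamma>b (x (Suc j)) + ereal (1 - \<tau>) * Q \<le> \<Gamma> (Suc j) (x (Suc j))"
      using upd[OF j] by (auto simp: model_update_def Q_def)
    have "ereal (m j + \<mu> / 2 * d\<^sup>2) \<le> \<Gamma>b (x (Suc j))"
      using Argmin_growth[OF \<Gamma>b(1,3), of "x (Suc j)"] m[OF j] \<Gamma>b(2) by (simp add: d_def)
    then have b: "ereal \<tau> * ereal (m j + \<mu> / 2 * d\<^sup>2) \<le> ereal \<tau> * \<Gamma>b (x (Suc j))"
      using \<tau> by (intro ereal_mult_left_mono) auto
    have "ereal (w (Suc j)) \<le> Q + ereal B"
      using q_bound[OF xS xS, of "Suc j" j] by (simp add: w d_def B_def Q_def)
    then have "ereal (w (Suc j) - B) \<le> Q"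
      by (cases Q) auto
    then have "ereal (1 - \<tau>) * ereal (w (Suc j) - B) \<le> ereal (1 - \<tau>) * Q"
      using \<tau> by (intro ereal_mult_left_mono) auto
    from order_trans[OF add_mono[OF b this] le]
    have "\<tau> * (m j + \<mu> / 2 * d\<^sup>2) + (1 - \<tau>) * (w (Suc j) - B) \<le> m (Suc j)"
      by (simp add: m)
    moreover have "(1 - \<tau>) * B \<le> \<tau> * (\<mu> / 2 * d\<^sup>2) + (1 - \<tau>) * (\<epsilon> / 4)"
      unfolding B_def using tau_calibration \<open>\<mu> > 0\<close> \<open>\<epsilon> > 0\<close> \<open>L \<ge> 0\<close> T2pos \<tau>(1) \<tau>eq by blast
    \<comment> \<open>The best value so far is bounded both by the previous best and by the newest
      value. Weighting these bounds by \<tau> and 1 - \<tau> matches the weights of the old model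
      and the new linearization.\<close>
    moreover have "v (Suc j) \<le> \<tau> * v j + (1 - \<tau>) * w (Suc j)"
    proof -
      have "\<tau> * v (Suc j) \<le> \<tau> * v j" "(1 - \<tau>) * v (Suc j) \<le> (1 - \<tau>) * w (Suc j)"
        using v_decr[OF j] v_le[of "Suc j" "Suc j"] \<tau> by (auto intro: mult_left_mono)
      then show ?thesis
        by (simp add: algebra_simps)
    qed
    ultimately show ?thesis
      by (simp add: t_def algebra_simps)
  qed
  have "tbar > 0"
    using \<open>D > 0\<close> \<open>L \<ge> 0\<close> by (simp add: \<open>tbar = _\<close> add_nonneg_pos)
  have "1 + 8 * (M\<^sup>2 + \<epsilon> * L) / (\<mu> * \<epsilon>) = 1 / (1 - \<tau>)"
  proof -
    have "\<tau> * (\<mu> * \<epsilon>) = (1 - \<tau>) * (8 * (M\<^sup>2 + \<epsilon> * L))"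
      using tau_relation[OF _ \<tau>(1) \<tau>eq] T2pos by simp
    then have "(1 - \<tau>) * (8 * (M\<^sup>2 + \<epsilon> * L) / (\<mu> * \<epsilon>)) = \<tau>"
      using \<open>\<mu> > 0\<close> \<open>\<epsilon> > 0\<close>
      by (metis less_numeral_extra(3) mult_pos_pos
          nonzero_mult_div_cancel_right times_divide_eq_right)
    then have "(1 - \<tau>) * (1 + 8 * (M\<^sup>2 + \<epsilon> * L) / (\<mu> * \<epsilon>)) = 1"
      by (simp add: distrib_left)
    then show ?thesis
      using \<tau>(2) by (simp add: eq_divide_eq mult.commute)
  qed
  then have N: "N = 1 + ln (4 * tbar / (3 * \<epsilon>)) / (1 - \<tau>)"
    by (simp add: \<open>N = _\<close>)
  have t_le: "t j \<le> \<epsilon>" if "j \<ge> 1" "real j \<ge> N" for j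
    using contraction_reaches[OF \<tau> \<open>tbar > 0\<close> \<open>\<epsilon> > 0\<close>, of t] t1 step that N by blast
  have "finds_eps_optimal_within \<phi> \<epsilon> y N"
    unfolding finds_eps_optimal_within_def
  \<comment> \<open>The last admissible iteration is the witness. The maximum with 1 covers
    \<open>4 * tbar < 3 * \<epsilon>\<close>, where the logarithm is negative and
    \<open>N < 1\<close>.\<close>
  proof (intro exI[of _ "nat (max 1 \<lceil>N\<rceil>)"] conjI)
    define j where "j = nat (max 1 \<lceil>N\<rceil>)"
    have j: "j \<ge> 1" "real j \<ge> N"
      unfolding j_def by linarith+
    show "1 \<le> nat (max 1 \<lceil>N\<rceil>)" "int (nat (max 1 \<lceil>N\<rceil>)) \<le> max 1 \<lceil>N\<rceil>"
      by auto
    have "ereal (m j) \<le> \<phi> u" for u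
      using xmin_le[OF j(1)] \<Gamma>_le[OF j(1)] m[OF j(1)] by (metis order_trans)
    then have "ereal (m j) \<le> min_value \<phi>"
      by (simp add: min_value_def INF_greatest)
    then have "\<phi> (y j) - min_value \<phi> \<le> \<phi> (y j) - ereal (m j)"
      by (intro ereal_minus_mono) auto
    also have "\<dots> \<le> ereal \<epsilon>"
      using t_le[OF j] v[OF j(1)] by (simp add: t_def)
    finally show "eps_optimal \<phi> \<epsilon> (y (nat (max 1 \<lceil>N\<rceil>)))"
      by (simp add: eps_optimal_def j_def)
  qed
  then show ?thesis
    using t_le t by simp
qed

end
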